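(* Let $S$ be an inverse semigroup with zero and identity $1_S$, and let $S_0=\{s\in S\mid s^*se\neq0\text{ and }ss^*e\neq0\text{ for all }e\in E(S)\setminus\{0\}\}$ be its core. Suppose further that for all $e\in E(S)\setminus\{0\}$ there exists $s\in S$ such that $ss^*=e$ and $s^*s=1_S$, and that the tight groupoid $\mathcal{G}_{\text{tight}}(S)$ is Hausdorff. Then $\mathcal{G}_{\text{tight}}(S)$ is essentially principal if and only if for all $s\in S_0$, every interior fixed point of $s$ is trivially fixed, i.e. $\mathring{F}_s\subset TF_s$.
   Context: All semigroups are countable and discrete. $E(S)$ denotes the semilattice of idempotents of $S$, and $s\leqslant t\iff s=ts^*s$ is the natural order. Tight groupoid: a filter in $E(S)$ is a nonempty proper subset $\xi\subset E(S)$ closed under products and upwards closed. Ultrafilters are maximal filters. The set of filters has the subspace topology from $\{0,1\}^{E(S)}$; $\widehat E_{\text{tight}}(S)$ is the closure of the set of ultrafilters in the space of filters. For $e\in E(S)$ let $D_e=\{\xi\in\widehat E_{\text{tight}}(S)\mid e\in\xi\}$, and for $s\in S$ let $\theta_s:D_{s^*s}\to D_{ss^*}$ send $\xi$ to the upwards closure of $\{ses^*\mid e\in\xi\}$; this is an action of $S$. $\mathcal{G}_{\text{tight}}(S)$ is its groupoid of germs: the set of classes $[s,x]$ of pairs $(s,x)$ with $s\in S$, $x\in D_{s^*s}$, where $(s,x)\sim(t,y)$ iff $x=y$ and there is $e\in E(S)$ with $x\in D_e$ and $se=te$; $d([s,x])=x$, $r([s,x])=\theta_s(x)$, $[s,x]^{-1}=[s^*,\theta_s(x)]$,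 $[t,\theta_s(x)][s,x]=[ts,x]$; the topology has basis the sets $\{[s,x]\mid x\in U\}$ for $s\in S$, $U\subset D_{s^*s}$ open. A topological groupoid $\mathcal{G}$ is essentially principal if the interior of its isotropy bundle $\{\gamma\mid r(\gamma)=d(\gamma)\}$ equals $\mathcal{G}^{(0)}$. For $s\in S$: $F_s=\{x\in D_{s^*s}\mid\theta_s(x)=x\}$ is the set of fixed points, $\mathring{F}_s$ is its interior in $\widehat E_{\text{tight}}(S)$ (the interior fixed points), and $TF_s=\{x\mid\text{there is } e\in E(S)\text{ with }0\neq e\leqslant s\text{ and }x\in D_e\}$ is the set of trivially fixed points. *)

theory Defs
  imports "HOL-Analysis.Analysis"
begin

section \<open>Inverse semigroups\<close>

class inverse_semigroup = semigroup_mult +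
  fixes star :: "'a \<Rightarrow> 'a"  ("(_\<^sup>\<star>)" [1000] 1000)
  assumes star_regular: "s * s\<^sup>\<star> * s = s"
    and star_regular': "s\<^sup>\<star> * s * s\<^sup>\<star> = s\<^sup>\<star>"
    and star_unique: "s * t * s = s \<Longrightarrow> t * s * t = t \<Longrightarrow> t = s\<^sup>\<star>"

definition idems :: "'a::inverse_semigroup set" where
  "idems = {e. e * e = e}"

definition nat_le :: "'a::inverse_semigroup \<Rightarrow> 'a \<Rightarrow> bool"  (infix "\<preceq>" 50) where
  "s \<preceq> t \<longleftrightarrow> s = t * s\<^sup>\<star> * s"

definition core :: "'a::{inverse_semigroup, mult_zero} set" where
  "core = {s. \<forall>e\<in>idems - {0}. s\<^sup>\<star> * s * e \<noteq> 0 \<and> s * s\<^sup>\<star> * e \<noteq> 0}"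


section \<open>The tight spectrum\<close>

definition filters :: "'a::inverse_semigroup set set" where
  "filters = {\<xi>. \<xi> \<noteq> {} \<and> \<xi> \<subset> idems \<and> (\<forall>e\<in>\<xi>. \<forall>f\<in>\<xi>. e * f \<in> \<xi>) \<and>
                  (\<forall>e\<in>\<xi>. \<forall>f\<in>idems. e \<preceq> f \<longrightarrow> f \<in> \<xi>)}"

definition ultrafilters :: "'a::inverse_semigroup set set" where
  "ultrafilters = {\<xi>\<in>filters. \<forall>\<eta>\<in>filters. \<xi> \<subseteq> \<eta> \<longrightarrow> \<eta> = \<xi>}"

text \<open>
  A filter is a point of \<open>{0,1}\<close> to the power \<open>E(S)\<close> through its characteristic function;
  pulling back along this injection is the same as taking the subspace topology.
\<close>

definition filter_topology :: "'a::inverse_semigroup set topology" where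
  "filter_topology =
     pullback_topology filters (\<lambda>\<xi>. \<lambda>e\<in>idems. e \<in> \<xi>)
       (product_topology (\<lambda>_. discrete_topology (UNIV :: bool set)) idems)"

definition tight_filters :: "'a::inverse_semigroup set set" where
  "tight_filters = filter_topology closure_of ultrafilters"

definition tight_topology :: "'a::inverse_semigroup set topology" where
  "tight_topology = subtopology filter_topology tight_filters"

definition dom_of :: "'a::inverse_semigroup \<Rightarrow> 'a set set" where
  "dom_of e = {\<xi>\<in>tight_filters. e \<in> \<xi>}"

definition act :: "'a::inverse_semigroup \<Rightarrow> 'a set \<Rightarrow> 'a set" where
  "act s \<xi> = {f\<in>idems. \<exists>e\<in>\<xi>. s * e * s\<^sup>\<star> \<preceq> f}"

definition fixed_points :: "'a::inverse_semigroup \<Rightarrow> 'a set set" where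
  "fixed_points s = {x\<in>dom_of (s\<^sup>\<star> * s). act s x = x}"

definition trivially_fixed :: "'a::{inverse_semigroup, mult_zero} \<Rightarrow> 'a set set" where
  "trivially_fixed s = {x. \<exists>e\<in>idems. e \<noteq> 0 \<and> e \<preceq> s \<and> x \<in> dom_of e}"


section \<open>Topological groupoids\<close>

text \<open>
  Arrows and objects are kept apart, and objects are embedded among the arrows by \<open>unit_at\<close>;
  the unit space as a set of arrows is the image of that map.
\<close>

record ('g, 'x) top_groupoid =
  arrows :: "'g topology"
  objects :: "'x topology"
  source_of :: "'g \<Rightarrow> 'x"
  range_of :: "'g \<Rightarrow> 'x"
  unit_at :: "'x \<Rightarrow> 'g"
  inv_of :: "'g \<Rightarrow> 'g"
  comp_of :: "'g \<Rightarrow> 'g \<Rightarrow> 'g"  \<comment> \<open>meaningful for \<open>comp_of \<gamma> \<delta>\<close> when \<open>source_of \<gamma> = range_of \<delta>\<close>\<close>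

definition unit_space :: "('g, 'x) top_groupoid \<Rightarrow> 'g set" where
  "unit_space G = unit_at G ` topspace (objects G)"

definition isotropy :: "('g, 'x) top_groupoid \<Rightarrow> 'g set" where
  "isotropy G = {\<gamma>\<in>topspace (arrows G). range_of G \<gamma> = source_of G \<gamma>}"

definition essentially_principal :: "('g, 'x) top_groupoid \<Rightarrow> bool" where
  "essentially_principal G \<longleftrightarrow> arrows G interior_of isotropy G = unit_space G"


section \<open>The tight groupoid\<close>

definition germ_rel :: "(('a::inverse_semigroup \<times> 'a set) \<times> ('a \<times> 'a set)) set" where
  "germ_rel = {((s, x), (t, y)). x \<in> dom_of (s\<^sup>\<star> * s) \<and> y \<in> dom_of (t\<^sup>\<star> * t) \<and> x = y \<and>
                 (\<exists>e\<in>idems. x \<in> dom_of e \<and> s * e = t * e)}"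

type_synonym 'a germ = "('a \<times> 'a set) set"

definition germ :: "'a::inverse_semigroup \<Rightarrow> 'a set \<Rightarrow> 'a germ" where
  "germ s x = germ_rel `` {(s, x)}"

definition germ_basis :: "'a::inverse_semigroup germ set set" where
  "germ_basis = {germ s ` U | s U. U \<subseteq> dom_of (s\<^sup>\<star> * s) \<and> openin tight_topology U}"

text \<open>
  The structure maps are given by formulas in a representative of each germ, and \<open>the_elem\<close> is
  applied to singletons only: see \<open>source_of_germ\<close>, \<open>range_of_germ\<close>, \<open>unit_at_germ\<close>, \<open>inv_of_germ\<close>
  and \<open>comp_of_germ\<close>. The sets in \<open>germ_basis\<close> cover all germs (\<open>topspace_arrows\<close>).
\<close>

definition tight_groupoid :: "('a::inverse_semigroup germ, 'a set) top_groupoid" where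
  "tight_groupoid =
    \<lparr> arrows = topology_generated_by germ_basis,
      objects = tight_topology,
      source_of = (\<lambda>\<gamma>. the_elem {x | s x. (s, x) \<in> \<gamma>}),
      range_of = (\<lambda>\<gamma>. the_elem {act s x | s x. (s, x) \<in> \<gamma>}),
      unit_at = (\<lambda>x. the_elem {germ e x | e. e \<in> x}),
      inv_of = (\<lambda>\<gamma>. the_elem {germ (s\<^sup>\<star>) (act s x) | s x. (s, x) \<in> \<gamma>}),
      comp_of = (\<lambda>\<gamma> \<delta>. the_elem {germ (t * s) x | t y s x. (t, y) \<in> \<gamma> \<and> (s, x) \<in> \<delta>}) \<rparr>"

lemma star_star: "(s::'a::inverse_semigroup)\<^sup>\<star>\<^sup>\<star> = s"
  by (metis star_regular star_regular' star_unique)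

lemma star_regular_assoc:
  "(s::'a::inverse_semigroup) * (s\<^sup>\<star> * s) = s"
  "s * (s\<^sup>\<star> * (s * z)) = s * z"
  "s\<^sup>\<star> * (s * s\<^sup>\<star>) = s\<^sup>\<star>"
  "s\<^sup>\<star> * (s * (s\<^sup>\<star> * z)) = s\<^sup>\<star> * z"
  by (simp_all add: mult.assoc[symmetric] star_regular star_regular')

lemma absorb_mult:
  fixes f a b c t u :: "'a::semigroup_mult"
  shows "f * a = a \<Longrightarrow> f * (a * c) = a * c"
    and "f * a = a \<Longrightarrow> t * f = u * f \<Longrightarrow> t * a = u * a"
    and "t * f = u * f \<Longrightarrow> t * (f * a) = u * (f * a)"
    and "f * a = a \<Longrightarrow> b = a * c \<Longrightarrow> f * b = b"
proof -
  show *: "f * a = a \<Longrightarrow> f * (a * c) = a * c" for a c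
    by (simp only: mult.assoc[symmetric])
  show **: "t * f = u * f \<Longrightarrow> t * (f * a) = u * (f * a)" for a
    by (simp only: mult.assoc[symmetric])
  show "f * a = a \<Longrightarrow> t * f = u * f \<Longrightarrow> t * a = u * a"
    using **[of a] by simp
  show "f * a = a \<Longrightarrow> b = a * c \<Longrightarrow> f * b = b"
    using *[of a c] by simp
qed

lemma idem_star: "(e::'a::inverse_semigroup) * e = e \<Longrightarrow> e\<^sup>\<star> = e"
  by (metis star_unique)

lemma idem_mult:
  fixes e f :: "'a::inverse_semigroup"
  assumes e: "e * e = e" and f: "f * f = f"
  shows "e * f * (e * f) = e * f"
proof -
  let ?x = "(e * f)\<^sup>\<star>"
  have r: "e * f * ?x * (e * f) = e * f" and r': "?x * (e * f) * ?x = ?x"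
    by (rule star_regular, rule star_regular')
  let ?y = "f * ?x * e"
  have ee: "e * (e * z) = e * z" and ff: "f * (f * z) = f * z" for z
    using e f by (metis mult.assoc)+
  have 1: "e * f * ?y * (e * f) = e * f"
    using r by (simp add: mult.assoc ee ff)
  have 2: "?y * (e * f) * ?y = ?y"
  proof -
    have "?y * (e * f) * ?y = f * (?x * (e * f) * ?x) * e" by (simp add: mult.assoc ee ff)
    then show ?thesis unfolding r' .
  qed
  have y: "?y = ?x" using star_unique[OF 1 2] .
  have "?y * ?y = ?y"
  proof -
    have "?y * ?y = f * (?x * (e * f) * ?x) * e" by (simp add: mult.assoc)
    then show ?thesis unfolding r' .
  qed
  then have xx: "?x * ?x = ?x" using y by simp
  have "e * f = ?x"
    using idem_star[OF xx] star_star[of "e * f"] by simp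
  then show ?thesis using xx by simp
qed

lemma idem_commute:
  fixes e f :: "'a::inverse_semigroup"
  assumes e: "e * e = e" and f: "f * f = f"
  shows "e * f = f * e"
proof -
  have ee: "e * (e * z) = e * z" and ff: "f * (f * z) = f * z" for z
    using e f by (metis mult.assoc)+
  have a: "e * (f * (e * f)) = e * f" and b: "f * (e * (f * e)) = f * e"
    using idem_mult[OF e f] idem_mult[OF f e] by (simp_all add: mult.assoc)
  have "f * e = (e * f)\<^sup>\<star>"
    by (rule star_unique) (simp_all add: mult.assoc ee ff a b)
  moreover have "e * f = (e * f)\<^sup>\<star>"
    using idem_star[OF idem_mult[OF e f]] by simp
  ultimately show ?thesis by simp
qed

lemma mult_idem_left: "(e::'a::inverse_semigroup) \<in> idems \<Longrightarrow> e * (e * z) = e * z"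
  by (simp add: idems_def mult.assoc[symmetric])

lemma idems_star: "(e::'a::inverse_semigroup) \<in> idems \<Longrightarrow> e\<^sup>\<star> = e"
  by (simp add: idems_def idem_star)

lemma idems_mult: "(e::'a::inverse_semigroup) \<in> idems \<Longrightarrow> f \<in> idems \<Longrightarrow> e * f \<in> idems"
  by (simp add: idems_def idem_mult)

lemma idems_commute: "(e::'a::inverse_semigroup) \<in> idems \<Longrightarrow> f \<in> idems \<Longrightarrow> e * f = f * e"
  by (simp add: idems_def idem_commute)

lemma idems_left_commute:
  "(e::'a::inverse_semigroup) \<in> idems \<Longrightarrow> f \<in> idems \<Longrightarrow> e * (f * z) = f * (e * z)"
  by (simp only: mult.assoc[symmetric] idems_commute[of e f])

lemma idems_absorb:
  fixes e p q :: "'a::inverse_semigroup"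
  assumes "e \<in> idems" "p \<in> idems" "q \<in> idems"
  shows "p * (e * p * q) = e * p * q" and "q * (e * p * q) = e * p * q"
proof -
  have q: "q * q = q" using assms by (simp add: idems_def)
  show "p * (e * p * q) = e * p * q"
    using assms by (simp add: mult.assoc idems_left_commute[of p e] mult_idem_left)
  show "q * (e * p * q) = e * p * q"
    using assms by (simp add: mult.assoc idems_left_commute[of q e] idems_left_commute[of q p] q)
qed

lemma idems_star_mult [simp]: "(s::'a::inverse_semigroup)\<^sup>\<star> * s \<in> idems"
  by (simp add: idems_def mult.assoc star_regular_assoc)

lemma idems_mult_star [simp]: "(s::'a::inverse_semigroup) * s\<^sup>\<star> \<in> idems"
  by (simp add: idems_def mult.assoc star_regular_assoc)

lemma star_mult: "((s::'a::inverse_semigroup) * t)\<^sup>\<star> = t\<^sup>\<star> * s\<^sup>\<star>"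
proof -
  have c: "(s\<^sup>\<star> * s) * (t * t\<^sup>\<star>) = (t * t\<^sup>\<star>) * (s\<^sup>\<star> * s)"
    by (simp add: idems_commute)
  have "s * t * (t\<^sup>\<star> * s\<^sup>\<star>) * (s * t) = s * ((t * t\<^sup>\<star>) * (s\<^sup>\<star> * s)) * t"
    by (simp add: mult.assoc)
  also have "\<dots> = (s * s\<^sup>\<star> * s) * (t * t\<^sup>\<star> * t)"
    by (simp add: c[symmetric]) (simp add: mult.assoc)
  finally have 1: "s * t * (t\<^sup>\<star> * s\<^sup>\<star>) * (s * t) = s * t"
    by (simp add: star_regular)
  have "t\<^sup>\<star> * s\<^sup>\<star> * (s * t) * (t\<^sup>\<star> * s\<^sup>\<star>) = t\<^sup>\<star> * ((s\<^sup>\<star> * s) * (t * t\<^sup>\<star>)) * s\<^sup>\<star>"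
    by (simp add: mult.assoc)
  also have "\<dots> = (t\<^sup>\<star> * t * t\<^sup>\<star>) * (s\<^sup>\<star> * s * s\<^sup>\<star>)"
    by (simp add: c) (simp add: mult.assoc)
  finally have 2: "t\<^sup>\<star> * s\<^sup>\<star> * (s * t) * (t\<^sup>\<star> * s\<^sup>\<star>) = t\<^sup>\<star> * s\<^sup>\<star>"
    by (simp add: star_regular')
  show ?thesis using star_unique[OF 1 2] by simp
qed

lemma conj_idems:
  fixes s :: "'a::inverse_semigroup"
  assumes e: "e \<in> idems"
  shows "s * e * s\<^sup>\<star> \<in> idems"
proof -
  have "(s * e) * (s * e)\<^sup>\<star> \<in> idems" by simp
  then show ?thesis
    using e by (simp add: star_mult idems_star mult.assoc mult_idem_left)
qed

lemma idems_le: "(e::'a::inverse_semigroup) \<in> idems \<Longrightarrow> e \<preceq> f \<longleftrightarrow> f * e = e"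
  unfolding nat_le_def by (auto simp: idems_star mult.assoc) (auto simp: idems_def)

lemma conj_absorb:
  fixes s :: "'a::inverse_semigroup"
  assumes e: "e \<in> idems"
  shows "s * e * s\<^sup>\<star> * (s * z) = s * (e * z)"
proof -
  have "s * e * s\<^sup>\<star> * (s * z) = s * (e * (s\<^sup>\<star> * s)) * z" by (simp add: mult.assoc)
  also have "\<dots> = s * ((s\<^sup>\<star> * s) * e) * z" by (simp add: idems_commute[OF e idems_star_mult])
  also have "\<dots> = (s * s\<^sup>\<star> * s) * (e * z)" by (simp add: mult.assoc)
  finally show ?thesis by (simp add: star_regular)
qed

lemma tight_filters_subset: "(tight_filters :: 'a::inverse_semigroup set set) \<subseteq> filters"
proof -
  have "tight_filters \<subseteq> topspace (filter_topology :: 'a set topology)"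
    by (simp add: tight_filters_def closure_of_subset_topspace)
  then show ?thesis
    by (auto simp: filter_topology_def topspace_pullback_topology)
qed

lemma tight_filter_idems: "x \<in> tight_filters \<Longrightarrow> e \<in> x \<Longrightarrow> e \<in> (idems :: 'a::inverse_semigroup set)"
  using tight_filters_subset by (auto simp: filters_def)

lemma tight_filter_mult:
  "x \<in> tight_filters \<Longrightarrow> e \<in> x \<Longrightarrow> f \<in> x \<Longrightarrow> (e::'a::inverse_semigroup) * f \<in> x"
  using tight_filters_subset by (auto simp: filters_def)

lemma tight_filter_up:
  "x \<in> tight_filters \<Longrightarrow> e \<in> x \<Longrightarrow> f \<in> idems \<Longrightarrow> f * e = e \<Longrightarrow> (f::'a::inverse_semigroup) \<in> x"
  using tight_filters_subset tight_filter_idems[of x e] by (auto simp: filters_def idems_le)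

lemma act_mem:
  "x \<in> tight_filters \<Longrightarrow> e \<in> x \<Longrightarrow> (s::'a::inverse_semigroup) * e * s\<^sup>\<star> \<in> act s x"
proof -
  assume x: "x \<in> tight_filters" and e: "e \<in> x"
  have i: "s * e * s\<^sup>\<star> \<in> idems"
    by (rule conj_idems[OF tight_filter_idems[OF x e]])
  then have "s * e * s\<^sup>\<star> \<preceq> s * e * s\<^sup>\<star>"
    unfolding idems_le[OF i] by (simp only: idems_def mem_Collect_eq)
  then show ?thesis using i e unfolding act_def by blast
qed

lemma equiv_germ_rel:
  "equiv {(s::'a::inverse_semigroup, x). x \<in> dom_of (s\<^sup>\<star> * s)} germ_rel"
proof (rule equivI)
  show "germ_rel \<subseteq> {(s::'a, x). x \<in> dom_of (s\<^sup>\<star> * s)} \<times> {(s, x). x \<in> dom_of (s\<^sup>\<star> * s)}"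
    by (auto simp: germ_rel_def)
  show "refl_on {(s::'a, x). x \<in> dom_of (s\<^sup>\<star> * s)} germ_rel"
    unfolding refl_on_def germ_rel_def using idems_star_mult by blast
  show "sym (germ_rel :: (('a \<times> 'a set) \<times> ('a \<times> 'a set)) set)"
    unfolding sym_def germ_rel_def by (clarsimp, metis)
  show "trans (germ_rel :: (('a \<times> 'a set) \<times> ('a \<times> 'a set)) set)"
  proof (rule transI)
    fix p q r :: "'a \<times> 'a set"
    assume 1: "(p, q) \<in> germ_rel" and 2: "(q, r) \<in> germ_rel"
    obtain s x where p: "p = (s, x)" by (cases p)
    obtain t y where q: "q = (t, y)" by (cases q)
    obtain u z where r: "r = (u, z)" by (cases r)
    have xy: "y = x" "z = x" and dx: "x \<in> dom_of (s\<^sup>\<star> * s)" "x \<in> dom_of (u\<^sup>\<star> * u)"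
      using 1 2 unfolding p q r germ_rel_def by blast+
    obtain e where e: "e \<in> idems" "x \<in> dom_of e" "s * e = t * e"
      using 1 unfolding p q germ_rel_def by blast
    obtain f where f: "f \<in> idems" "x \<in> dom_of f" "t * f = u * f"
      using 2 xy unfolding q r germ_rel_def by blast
    have "s * (e * f) = u * (e * f)"
      using absorb_mult(3)[OF e(3), of f] absorb_mult(3)[OF f(3), of e]
      unfolding idems_commute[OF f(1) e(1)] by (rule trans)
    moreover have "x \<in> dom_of (e * f)"
      using e f by (auto simp: dom_of_def tight_filter_mult)
    ultimately show "(p, r) \<in> germ_rel"
      using dx idems_mult[OF e(1) f(1)] unfolding p r xy germ_rel_def by blast
  qed
qed

lemma mem_germ:
  "(t, y) \<in> germ s x \<longleftrightarrow>
     y = x \<and> x \<in> dom_of (s\<^sup>\<star> * s) \<and> x \<in> dom_of (t\<^sup>\<star> * t) \<and> (\<exists>e\<in>x. s * e = (t::'a::inverse_semigroup) * e)"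
  by (auto simp: germ_def germ_rel_def dom_of_def dest: tight_filter_idems)

lemma germ_self: "x \<in> dom_of (s\<^sup>\<star> * s) \<Longrightarrow> (s::'a::inverse_semigroup, x) \<in> germ s x"
  by (auto simp: mem_germ dom_of_def)

lemma germ_eqI:
  assumes "x \<in> dom_of (s\<^sup>\<star> * s)" "x \<in> dom_of (t\<^sup>\<star> * t)" "e \<in> x" "s * e = (t::'a::inverse_semigroup) * e"
  shows "germ s x = germ t x"
  unfolding germ_def using assms
  by (intro equiv_class_eq[OF equiv_germ_rel])
    (auto simp: germ_rel_def dom_of_def dest: tight_filter_idems)

lemma act_cong_le:
  fixes s t :: "'a::inverse_semigroup"
  assumes x: "x \<in> tight_filters" and e: "e \<in> x" and eq: "s * e = t * e"
  shows "act s x \<subseteq> act t x"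
proof
  fix f assume "f \<in> act s x"
  then obtain g where g: "g \<in> x" and f: "f \<in> idems" and le: "s * g * s\<^sup>\<star> \<preceq> f"
    by (auto simp: act_def)
  have ei: "e \<in> idems" and gi: "g \<in> idems" using tight_filter_idems x e g by auto
  have conj: "u * (e * g) * u\<^sup>\<star> = (u * e) * g * (u * e)\<^sup>\<star>" for u :: 'a
    using ei gi
    by (simp add: star_mult idems_star mult.assoc idems_left_commute[of g e] mult_idem_left)
  have "f * (s * g * s\<^sup>\<star>) = s * g * s\<^sup>\<star>"
    using le gi by (simp add: idems_le conj_idems)
  moreover have "s * (e * g) * s\<^sup>\<star> = s * g * s\<^sup>\<star> * (s * e * s\<^sup>\<star>)"
    using conj_absorb[OF gi, of s "e * s\<^sup>\<star>"] by (simp add: mult.assoc idems_left_commute[OF ei gi])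
  ultimately have "f * (s * (e * g) * s\<^sup>\<star>) = s * (e * g) * s\<^sup>\<star>"
    by (rule absorb_mult(4))
  then have "f * (t * (e * g) * t\<^sup>\<star>) = t * (e * g) * t\<^sup>\<star>"
    using eq by (simp add: conj)
  then have "t * (e * g) * t\<^sup>\<star> \<preceq> f"
    using ei gi by (simp add: idems_le conj_idems idems_mult)
  then show "f \<in> act t x"
    using f x e g tight_filter_mult unfolding act_def by blast
qed

lemma act_cong:
  "x \<in> tight_filters \<Longrightarrow> e \<in> x \<Longrightarrow> s * e = t * e \<Longrightarrow> act (s::'a::inverse_semigroup) x = act t x"
  using act_cong_le[of x e s t] act_cong_le[of x e t s] by (simp only: subset_antisym)

lemma source_of_germ:
  assumes "x \<in> dom_of (s\<^sup>\<star> * s)"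
  shows "source_of tight_groupoid (germ (s::'a::inverse_semigroup) x) = x"
proof -
  have "{y | t y. (t, y) \<in> germ s x} = {x}"
    using germ_self[OF assms] by (auto simp: mem_germ)
  then show ?thesis by (simp add: tight_groupoid_def)
qed

lemma range_of_germ:
  assumes "x \<in> dom_of (s\<^sup>\<star> * s)"
  shows "range_of tight_groupoid (germ (s::'a::inverse_semigroup) x) = act s x"
proof -
  have "act t y = act s x" if "(t, y) \<in> germ s x" for t y
  proof -
    from that obtain e where "y = x" "e \<in> x" "s * e = t * e" by (auto simp only: mem_germ)
    then show ?thesis using assms act_cong[of x e s t] by (simp add: dom_of_def)
  qed
  then have "{act t y | t y. (t, y) \<in> germ s x} = {act s x}"
    using germ_self[OF assms] by blast
  then show ?thesis by (simp add: tight_groupoid_def)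
qed

lemma unit_at_germ:
  assumes x: "x \<in> dom_of (e::'a::inverse_semigroup)"
  shows "unit_at tight_groupoid x = germ e x"
proof -
  have xt: "x \<in> tight_filters" and ex: "e \<in> x" using x by (auto simp: dom_of_def)
  have d: "x \<in> dom_of (f\<^sup>\<star> * f)" if "f \<in> x" for f
    using that xt tight_filter_idems[OF xt that] by (simp add: dom_of_def idems_star idems_def)
  have "germ f x = germ e x" if f: "f \<in> x" for f
  proof (rule germ_eqI[of x f e "f * e"])
    have ei: "e \<in> idems" and fi: "f \<in> idems" using tight_filter_idems xt ex f by auto
    show "f * (f * e) = e * (f * e)"
      using idems_left_commute[OF ei fi, of e] mult_idem_left[OF fi, of e] ei by (simp add: idems_def)
    show "f * e \<in> x" using xt ex f by (simp add: tight_filter_mult)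
  qed (use d f ex in auto)
  then have "{germ f x | f. f \<in> x} = {germ e x}" using ex by blast
  then show ?thesis by (simp add: tight_groupoid_def)
qed

lemma inv_of_germ:
  assumes x: "x \<in> dom_of (s\<^sup>\<star> * s)" and ax: "act s x \<in> tight_filters"
  shows "inv_of tight_groupoid (germ (s::'a::inverse_semigroup) x) = germ (s\<^sup>\<star>) (act s x)"
proof -
  have xt: "x \<in> tight_filters" and sx: "s\<^sup>\<star> * s \<in> x" using x by (auto simp: dom_of_def)
  have d: "act t x \<in> dom_of (t\<^sup>\<star>\<^sup>\<star> * t\<^sup>\<star>)" if "t\<^sup>\<star> * t \<in> x" "act t x = act s x" for t
    using act_mem[OF xt that(1), of t] ax that by (simp add: dom_of_def star_star mult.assoc star_regular_assoc)
  have "germ (t\<^sup>\<star>) (act t y) = germ (s\<^sup>\<star>) (act s x)" if "(t, y) \<in> germ s x" for t y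
  proof -
    obtain e where y: "y = x" and tx: "t\<^sup>\<star> * t \<in> x" and e: "e \<in> x" and eq: "s * e = t * e"
      using \<open>(t, y) \<in> germ s x\<close> by (auto simp: mem_germ dom_of_def)
    have at: "act t x = act s x" using act_cong[OF xt e eq] by simp
    have ei: "e \<in> idems" using tight_filter_idems[OF xt e] .
    define g where "g = e * (s\<^sup>\<star> * s) * (t\<^sup>\<star> * t)"
    have g: "g \<in> x" unfolding g_def using xt e sx tx by (simp add: tight_filter_mult)
    have gi: "g \<in> idems" using tight_filter_idems[OF xt g] .
    have eg: "s * g = t * g" unfolding g_def by (simp add: mult.assoc[symmetric] eq)
    have sg: "s\<^sup>\<star> * s * g = g" and tg: "t\<^sup>\<star> * t * g = g"
      unfolding g_def by (rule idems_absorb; use ei in simp)+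
    have eq': "t\<^sup>\<star> * (s * g * s\<^sup>\<star>) = s\<^sup>\<star> * (s * g * s\<^sup>\<star>)"
    proof -
      have "t\<^sup>\<star> * (s * g * s\<^sup>\<star>) = t\<^sup>\<star> * t * g * s\<^sup>\<star>" unfolding eg by (simp add: mult.assoc)
      moreover have "s\<^sup>\<star> * (s * g * s\<^sup>\<star>) = s\<^sup>\<star> * s * g * s\<^sup>\<star>" by (simp add: mult.assoc)
      ultimately show ?thesis by (simp add: sg tg)
    qed
    have "germ (t\<^sup>\<star>) (act s x) = germ (s\<^sup>\<star>) (act s x)"
      by (rule germ_eqI[OF _ _ act_mem[OF xt g, of s] eq']) (use d[OF tx at] d[OF sx] at in auto)
    then show ?thesis using y at by simp
  qed
  then have "{germ (t\<^sup>\<star>) (act t y) | t y. (t, y) \<in> germ s x} = {germ (s\<^sup>\<star>) (act s x)}"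
    using germ_self[OF x] by blast
  then show ?thesis by (simp add: tight_groupoid_def)
qed

lemma comp_of_germ:
  assumes x: "x \<in> dom_of (s\<^sup>\<star> * s)" and ax: "act s x \<in> dom_of (t\<^sup>\<star> * t)"
  shows "comp_of tight_groupoid (germ t (act s x)) (germ s x) = germ ((t::'a::inverse_semigroup) * s) x"
proof -
  have xt: "x \<in> tight_filters" and sx: "s\<^sup>\<star> * s \<in> x" using x by (auto simp: dom_of_def)
  have d: "x \<in> dom_of ((u * v)\<^sup>\<star> * (u * v))"
    if v: "v\<^sup>\<star> * v \<in> x" and u: "u\<^sup>\<star> * u \<in> act v x" for u v :: 'a
  proof -
    obtain g where g: "g \<in> x" and le: "v * g * v\<^sup>\<star> \<preceq> u\<^sup>\<star> * u" using u by (auto simp: act_def)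
    have gi: "g \<in> idems" using tight_filter_idems[OF xt g] .
    have le': "u\<^sup>\<star> * u * (v * g * v\<^sup>\<star>) = v * g * v\<^sup>\<star>" using le gi by (simp add: idems_le conj_idems)
    have c: "v * (g * (v\<^sup>\<star> * v)) = v * g"
      by (simp add: idems_commute[OF gi idems_star_mult[of v]] mult.assoc star_regular_assoc)
    have "(u * v)\<^sup>\<star> * (u * v) * (v\<^sup>\<star> * v * g) = v\<^sup>\<star> * (u\<^sup>\<star> * u * (v * g))"
      by (simp add: star_mult mult.assoc star_regular_assoc)
    also have "\<dots> = v\<^sup>\<star> * (u\<^sup>\<star> * u * (v * g * v\<^sup>\<star>) * v)"
      using c by (simp add: mult.assoc)
    also have "\<dots> = v\<^sup>\<star> * v * g"
      unfolding le' using c by (simp add: mult.assoc)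
    finally have "(u * v)\<^sup>\<star> * (u * v) \<in> x"
      using tight_filter_up[OF xt tight_filter_mult[OF xt v g]] idems_star_mult by blast
    then show ?thesis using xt by (simp add: dom_of_def)
  qed
  have "germ (t' * s') x' = germ (t * s) x"
    if t': "(t', y) \<in> germ t (act s x)" and s': "(s', x') \<in> germ s x" for t' y s' x'
  proof -
    obtain e where x': "x' = x" and s'x: "s'\<^sup>\<star> * s' \<in> x" and e: "e \<in> x" and se: "s * e = s' * e"
      using s' by (auto simp: mem_germ dom_of_def)
    obtain f where t'x: "t'\<^sup>\<star> * t' \<in> act s x" and f: "f \<in> act s x" and tf: "t * f = t' * f"
      using t' by (auto simp: mem_germ dom_of_def)
    have tx: "t\<^sup>\<star> * t \<in> act s x" using ax by (auto simp: dom_of_def)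
    have as: "act s' x = act s x" using act_cong[OF xt e se] by simp
    obtain g where g: "g \<in> x" and le: "s * g * s\<^sup>\<star> \<preceq> f" using f by (auto simp: act_def)
    have ei: "e \<in> idems" and gi: "g \<in> idems" using tight_filter_idems xt e g by auto
    have le': "f * (s * g * s\<^sup>\<star>) = s * g * s\<^sup>\<star>" using le gi by (simp add: idems_le conj_idems)
    have sge: "f * (s * (g * e)) = s * (g * e)"
      using absorb_mult(1)[OF le', of "s * e"] by (simp only: conj_absorb[OF gi])
    have "s' * (g * e) = s * (g * e)"
      unfolding idems_commute[OF gi ei] by (simp add: absorb_mult(3)[OF se])
    then have "t' * s' * (g * e) = t' * (s * (g * e))" by (simp add: mult.assoc)
    also have "\<dots> = t * s * (g * e)"
      using absorb_mult(2)[OF sge tf] by (simp add: mult.assoc)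
    finally have eq: "t' * s' * (g * e) = t * s * (g * e)" .
    show ?thesis unfolding x'
      by (rule germ_eqI[OF d[OF s'x] d[OF sx] tight_filter_mult[OF xt g e] eq]) (use t'x tx as in auto)
  qed
  then have "{germ (t' * s') x' | t' y s' x'. (t', y) \<in> germ t (act s x) \<and> (s', x') \<in> germ s x} = {germ (t * s) x}"
    using germ_self[OF x] germ_self[OF ax] by blast
  then show ?thesis by (simp add: tight_groupoid_def)
qed

lemma topspace_filter_topology: "topspace filter_topology = (filters :: 'a::inverse_semigroup set set)"
  by (auto simp: filter_topology_def topspace_pullback_topology)

lemma topspace_arrows:
  "topspace (arrows tight_groupoid) = {germ s x | (s::'a::inverse_semigroup) x. x \<in> dom_of (s\<^sup>\<star> * s)}"
proof -
  have op: "openin tight_topology (dom_of (e::'a))" if e: "e \<in> idems" for e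
  proof -
    have c: "continuous_map filter_topology (discrete_topology UNIV) (\<lambda>\<xi>::'a set. e \<in> \<xi>)"
      unfolding filter_topology_def
      using continuous_map_pullback[OF continuous_map_product_projection[OF e, of "\<lambda>_. discrete_topology UNIV"],
          of filters "\<lambda>\<xi>. \<lambda>e\<in>idems. e \<in> \<xi>"] e
      by (simp add: o_def)
    have "openin filter_topology {\<xi>\<in>topspace filter_topology. (e \<in> \<xi>) \<in> {True}}"
      by (rule openin_continuous_map_preimage[OF c]) simp
    moreover have "dom_of e = tight_filters \<inter> {\<xi>\<in>topspace filter_topology. (e \<in> \<xi>) \<in> {True}}"
      using tight_filters_subset by (auto simp: dom_of_def topspace_filter_topology)
    ultimately show ?thesis by (metis tight_topology_def openin_subtopology_Int2)
  qed
  have "\<Union> germ_basis = {germ s x | (s::'a) x. x \<in> dom_of (s\<^sup>\<star> * s)}"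
  proof
    show "{germ s x | (s::'a) x. x \<in> dom_of (s\<^sup>\<star> * s)} \<subseteq> \<Union> germ_basis"
      unfolding germ_basis_def using op[OF idems_star_mult] by blast
  qed (auto simp: germ_basis_def)
  then show ?thesis by (simp add: tight_groupoid_def)
qed

end

theory Submission
  imports Defs
begin

text \<open>
  The germ of \<open>s\<close> at \<open>x\<close> is isotropic iff \<open>s\<close> fixes \<open>x\<close>, and it is a unit iff \<open>x\<close> is trivially
  fixed. Since \<open>germ s\<close> is continuous and open on the domain of \<open>s\<close>, essential principality says that
  for every \<open>s\<close> in the semigroup each interior fixed point is trivially fixed
  (\<open>essentially_principal_iff\<close>). One direction of the theorem is the restriction of this to the
  core, and it remains to pass from the core to an arbitrary \<open>s\<close>.

  Let \<open>y\<close> be an ultrafilter in the interior of the fixed points of \<open>s\<close>. The sets \<open>dom_of e\<close> with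
  \<open>e \<in> y\<close> form a neighbourhood basis of \<open>y\<close> (\<open>ultrafilter_basis\<close>), so \<open>s\<close> fixes all of \<open>dom_of e\<close>
  for one such \<open>e\<close>. Write \<open>e = t * t\<^sup>\<star>\<close> with \<open>t\<^sup>\<star> * t = 1\<close>. The action of \<open>t\<close> carries the whole tight
  spectrum into \<open>dom_of e\<close>, so \<open>u = t\<^sup>\<star> * s * t\<close> fixes every tight filter (\<open>fixed_corner\<close>). Both
  \<open>u\<^sup>\<star> * u\<close> and \<open>u * u\<^sup>\<star>\<close> then lie in every ultrafilter; as every nonzero idempotent lies in some
  ultrafilter, \<open>u\<close> is in the core (\<open>core_if_tight_fixed\<close>). By hypothesis \<open>act t\<^sup>\<star> y\<close> is trivially
  fixed by \<open>u\<close>, and conjugating back by \<open>t\<close> shows that \<open>y\<close> is trivially fixed by \<open>s\<close>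
  (\<open>trivially_fixed_corner\<close>).

  A neighbourhood basis of this kind is not available at a general tight filter, and here the
  Hausdorff property enters: units and nonunits are separated by open sets of germs, ultrafilters are
  dense, and so it is enough to treat them (\<open>trivially_fixed_if_ultrafilters\<close>).
\<close>

section \<open>Filters and the action\<close>

lemma filter_idems: "x \<in> filters \<Longrightarrow> e \<in> x \<Longrightarrow> e \<in> (idems :: 'a::inverse_semigroup set)"
  by (auto simp: filters_def)

lemma filter_mult: "x \<in> filters \<Longrightarrow> e \<in> x \<Longrightarrow> f \<in> x \<Longrightarrow> (e::'a::inverse_semigroup) * f \<in> x"
  by (auto simp: filters_def)

lemma filter_up:
  "x \<in> filters \<Longrightarrow> e \<in> x \<Longrightarrow> f \<in> idems \<Longrightarrow> f * e = e \<Longrightarrow> (f::'a::inverse_semigroup) \<in> x"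
  using filter_idems[of x e] by (auto simp: filters_def idems_le)

lemma conj_star_idems:
  "e \<in> idems \<Longrightarrow> (s::'a::inverse_semigroup)\<^sup>\<star> * e * s \<in> idems"
  using conj_idems[of e "s\<^sup>\<star>"] by (simp add: star_star)

lemma zero_idems: "(0::'a::{inverse_semigroup, mult_zero}) \<in> idems"
  by (simp add: idems_def)

lemma filter_nonempty: "x \<in> filters \<Longrightarrow> \<exists>e. e \<in> (x :: 'a::inverse_semigroup set)"
  by (auto simp: filters_def)

lemma zero_notin_filter:
  assumes x: "x \<in> filters"
  shows "(0::'a::{inverse_semigroup, mult_zero}) \<notin> x"
proof
  assume "0 \<in> x"
  then have "e \<in> x" if "e \<in> idems" for e using filter_up[OF x _ that] by simp
  then show False using x unfolding filters_def by blast
qed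

lemma filterI:
  assumes "e \<in> x" "x \<subseteq> idems" "(0::'a::{inverse_semigroup, mult_zero}) \<notin> x"
    and "\<And>e f. e \<in> x \<Longrightarrow> f \<in> x \<Longrightarrow> e * f \<in> x"
    and up: "\<And>e f. e \<in> x \<Longrightarrow> f \<in> idems \<Longrightarrow> f * e = e \<Longrightarrow> f \<in> x"
  shows "x \<in> filters"
proof -
  have "f \<in> x" if e: "e \<in> x" and f: "f \<in> idems" "e \<preceq> f" for e f
  proof -
    have "e \<in> idems" using e assms(2) by blast
    then show ?thesis using up[OF e f(1)] f(2) idems_le by blast
  qed
  moreover have "x \<subset> idems" using assms(2,3) zero_idems by blast
  ultimately show ?thesis using assms(1,4) unfolding filters_def by blast
qed

text \<open>
  Membership in \<open>act s x\<close> is decided by a single idempotent, so that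
  preservation of filters, composition and continuity of the action become calculations with
  preimages under \<open>f \<mapsto> s\<^sup>\<star> * f * s\<close>.
\<close>

lemma mem_act:
  fixes s :: "'a::inverse_semigroup"
  assumes x: "x \<in> filters" and sx: "s\<^sup>\<star> * s \<in> x" and f: "f \<in> idems"
  shows "f \<in> act s x \<longleftrightarrow> s\<^sup>\<star> * f * s \<in> x"
proof
  assume "f \<in> act s x"
  then obtain e where e: "e \<in> x" and le: "s * e * s\<^sup>\<star> \<preceq> f" by (auto simp: act_def)
  have ei: "e \<in> idems" using filter_idems[OF x e] .
  have fs: "f * (s * e * s\<^sup>\<star>) = s * e * s\<^sup>\<star>" using le ei by (simp add: idems_le conj_idems)
  have se: "s * e * s\<^sup>\<star> * s = s * e"
    using idems_commute[OF ei idems_star_mult[of s]] by (simp add: mult.assoc star_regular_assoc)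
  have "f * (s * e) = s * e"
    using fs se by (metis mult.assoc)
  then have "s\<^sup>\<star> * f * s * (s\<^sup>\<star> * s * e) = s\<^sup>\<star> * s * e"
    by (simp add: mult.assoc star_regular_assoc)
  then show "s\<^sup>\<star> * f * s \<in> x"
    using filter_up[OF x filter_mult[OF x sx e]] conj_star_idems[OF f] by blast
next
  assume e: "s\<^sup>\<star> * f * s \<in> x"
  let ?e = "s\<^sup>\<star> * f * s"
  have "s * ?e * s\<^sup>\<star> = s * s\<^sup>\<star> * f * (s * s\<^sup>\<star>)" by (simp add: mult.assoc)
  also have "f * \<dots> = \<dots>"
    using idems_left_commute[OF f idems_mult_star[of s], of "f * (s * s\<^sup>\<star>)"] mult_idem_left[OF f, of "s * s\<^sup>\<star>"]
    by (simp add: mult.assoc)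
  finally have "f * (s * ?e * s\<^sup>\<star>) = s * ?e * s\<^sup>\<star>"
    by (simp add: mult.assoc)
  then have "s * ?e * s\<^sup>\<star> \<preceq> f"
    by (subst idems_le) (use conj_star_idems[OF f] conj_idems in auto)
  then show "f \<in> act s x" using e f by (auto simp: act_def)
qed

lemma act_eq:
  fixes s :: "'a::inverse_semigroup"
  assumes "x \<in> filters" "s\<^sup>\<star> * s \<in> x"
  shows "act s x = {f\<in>idems. s\<^sup>\<star> * f * s \<in> x}"
  using mem_act[OF assms] by (auto simp: act_def)

lemma act_range_proj:
  fixes s :: "'a::inverse_semigroup"
  assumes "x \<in> filters" "s\<^sup>\<star> * s \<in> x"
  shows "s * s\<^sup>\<star> \<in> act s x"
  using assms by (simp add: act_eq mult.assoc star_regular_assoc)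

lemma act_mult:
  fixes s t :: "'a::inverse_semigroup"
  assumes x: "x \<in> filters" "s\<^sup>\<star> * s \<in> x" and ax: "act s x \<in> filters" "t\<^sup>\<star> * t \<in> act s x"
  shows "(t * s)\<^sup>\<star> * (t * s) \<in> x" and "act (t * s) x = act t (act s x)"
proof -
  show d: "(t * s)\<^sup>\<star> * (t * s) \<in> x"
    using ax(2) by (simp add: act_eq[OF x] star_mult mult.assoc)
  show "act (t * s) x = act t (act s x)"
    unfolding act_eq[OF x(1) d] act_eq[OF ax]
    using mem_act[OF x conj_star_idems[of _ t]] by (auto simp: star_mult mult.assoc)
qed

lemma act_filter:
  fixes s :: "'a::{inverse_semigroup, mult_zero}"
  assumes x: "x \<in> filters" and sx: "s\<^sup>\<star> * s \<in> x"
  shows "act s x \<in> filters"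
proof -
  have "e * f \<in> act s x" if "e \<in> act s x" "f \<in> act s x" for e f
  proof -
    have e: "e \<in> idems" "s\<^sup>\<star> * e * s \<in> x" and f: "f \<in> idems" "s\<^sup>\<star> * f * s \<in> x"
      using that by (auto simp: act_eq[OF x sx])
    have "s\<^sup>\<star> * e * s * (s\<^sup>\<star> * f * s) = s\<^sup>\<star> * (e * (s * s\<^sup>\<star>)) * f * s" by (simp add: mult.assoc)
    also have "\<dots> = s\<^sup>\<star> * (e * f) * s"
      by (simp add: idems_commute[OF e(1) idems_mult_star]) (simp add: mult.assoc star_regular_assoc)
    finally show ?thesis
      using filter_mult[OF x e(2) f(2)] idems_mult[OF e(1) f(1)] by (simp add: act_eq[OF x sx])
  qed
  moreover have "f \<in> act s x" if "e \<in> act s x" "f \<in> idems" "f * e = e" for e f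
  proof -
    have e: "e \<in> idems" "s\<^sup>\<star> * e * s \<in> x" using that by (auto simp: act_eq[OF x sx])
    have "s\<^sup>\<star> * f * s * (s\<^sup>\<star> * e * s) = s\<^sup>\<star> * (f * (s * s\<^sup>\<star>)) * e * s" by (simp add: mult.assoc)
    also have "\<dots> = s\<^sup>\<star> * (f * e) * s"
      by (simp add: idems_commute[OF that(2) idems_mult_star]) (simp add: mult.assoc star_regular_assoc)
    finally have "s\<^sup>\<star> * f * s * (s\<^sup>\<star> * e * s) = s\<^sup>\<star> * e * s" by (simp add: that)
    then show ?thesis
      using filter_up[OF x e(2) conj_star_idems[OF that(2)]] that(2) by (simp add: act_eq[OF x sx])
  qed
  moreover have "0 \<notin> act s x" using zero_notin_filter[OF x] by (simp add: act_eq[OF x sx])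
  moreover have "act s x \<subseteq> idems" by (auto simp: act_def)
  ultimately show ?thesis by (intro filterI[OF act_range_proj[OF x sx]])
qed

lemma act_idem:
  fixes e :: "'a::inverse_semigroup"
  assumes x: "x \<in> filters" and e: "e \<in> x"
  shows "act e x = x"
proof -
  have ei: "e \<in> idems" using filter_idems[OF x e] .
  have ee: "e * e = e" using ei by (simp add: idems_def)
  have "e * f * e \<in> x \<longleftrightarrow> f \<in> x" if f: "f \<in> idems" for f
  proof -
    have "e * f * e = e * f"
      using mult_idem_left[OF ei, of f] by (simp add: mult.assoc idems_commute[OF f ei])
    moreover have "f * (e * f) = e * f"
      using idems_left_commute[OF f ei, of f] f by (simp add: idems_def)
    ultimately show ?thesis
      using filter_up[OF x _ f, of "e * f"] filter_mult[OF x e, of f] by auto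
  qed
  then have "act e x = {f \<in> idems. f \<in> x}"
    using act_eq[OF x, of e] e by (auto simp: ee idems_star[OF ei])
  then show ?thesis using filter_idems[OF x] by auto
qed

lemma act_star_act:
  fixes s :: "'a::{inverse_semigroup, mult_zero}"
  assumes x: "x \<in> filters" and sx: "s\<^sup>\<star> * s \<in> x"
  shows "act (s\<^sup>\<star>) (act s x) = x"
proof -
  have "s\<^sup>\<star>\<^sup>\<star> * s\<^sup>\<star> \<in> act s x" using act_range_proj[OF x sx] by (simp add: star_star)
  from act_mult(2)[OF x sx act_filter[OF x sx] this] show ?thesis
    using act_idem[OF x sx] by simp
qed

lemma act_mono: "x \<subseteq> y \<Longrightarrow> act s x \<subseteq> act s y"
  unfolding act_def by blast

text \<open>
  The action of \<open>s\<close> is a monotone bijection between the filters containing \<open>s\<^sup>\<star> * s\<close> and those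
  containing \<open>s * s\<^sup>\<star>\<close>, with inverse the action of \<open>s\<^sup>\<star>\<close>. Filters above a filter in one of these sets
  stay in it, so maximal filters correspond to each other.
\<close>

lemma act_ultrafilter:
  fixes s :: "'a::{inverse_semigroup, mult_zero}"
  assumes x: "x \<in> ultrafilters" and sx: "s\<^sup>\<star> * s \<in> x"
  shows "act s x \<in> ultrafilters"
proof -
  have xf: "x \<in> filters" using x by (simp add: ultrafilters_def)
  have "y = act s x" if y: "y \<in> filters" "act s x \<subseteq> y" for y
  proof -
    have sy: "s\<^sup>\<star>\<^sup>\<star> * s\<^sup>\<star> \<in> y" using act_range_proj[OF xf sx] y by (auto simp: star_star)
    have "x \<subseteq> act (s\<^sup>\<star>) y" using act_mono[OF y(2), of "s\<^sup>\<star>"] act_star_act[OF xf sx] by simp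
    then have "act (s\<^sup>\<star>) y = x"
      using x act_filter[OF y(1) sy] by (auto simp: ultrafilters_def)
    then show ?thesis using act_star_act[OF y(1) sy] by (simp add: star_star)
  qed
  then show ?thesis using act_filter[OF xf sx] by (auto simp: ultrafilters_def)
qed


section \<open>The tight spectrum\<close>

lemma continuous_map_mem_filter:
  assumes e: "(e::'a::inverse_semigroup) \<in> idems"
  shows "continuous_map filter_topology (discrete_topology UNIV) (\<lambda>x. e \<in> x)"
  unfolding filter_topology_def
  using continuous_map_pullback[OF continuous_map_product_projection[OF e, of "\<lambda>_. discrete_topology UNIV"],
      of filters "\<lambda>x. \<lambda>e\<in>idems. e \<in> x"] e
  by (simp add: o_def)

lemma openin_filter_mem:
  assumes e: "(e::'a::inverse_semigroup) \<in> idems"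
  shows "openin filter_topology {x\<in>filters. e \<in> x}"
  using openin_continuous_map_preimage[OF continuous_map_mem_filter[OF e], of "{True}"]
  by (simp add: topspace_filter_topology)

lemma openin_dom_of:
  assumes e: "(e::'a::inverse_semigroup) \<in> idems"
  shows "openin tight_topology (dom_of e)"
proof -
  have "dom_of e = tight_filters \<inter> {x\<in>filters. e \<in> x}"
    using tight_filters_subset by (auto simp: dom_of_def)
  then show ?thesis using openin_filter_mem[OF e]
    by (metis tight_topology_def openin_subtopology_Int2)
qed

lemma topspace_tight: "topspace tight_topology = (tight_filters :: 'a::inverse_semigroup set set)"
  using tight_filters_subset by (auto simp: tight_topology_def topspace_filter_topology)

lemma ultrafilters_tight: "ultrafilters \<subseteq> (tight_filters :: 'a::inverse_semigroup set set)"
  unfolding tight_filters_def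
  by (rule closure_of_subset) (auto simp: topspace_filter_topology ultrafilters_def)

lemma open_contains_ultrafilter:
  assumes U: "openin tight_topology U" and x: "(x::'a::inverse_semigroup set) \<in> U"
  shows "\<exists>y\<in>ultrafilters. y \<in> U"
proof -
  obtain V where V: "openin filter_topology V" "U = V \<inter> tight_filters"
    using U by (auto simp: tight_topology_def openin_subtopology)
  have "x \<in> filter_topology closure_of ultrafilters" "x \<in> V"
    using x V by (auto simp: tight_filters_def)
  then obtain y where "y \<in> ultrafilters" "y \<in> V"
    using V(1) unfolding in_closure_of by blast
  then show ?thesis using V ultrafilters_tight by blast
qed

lemma continuous_map_act:
  fixes s :: "'a::{inverse_semigroup, mult_zero}"
  shows "continuous_map (subtopology filter_topology {x\<in>filters. s\<^sup>\<star> * s \<in> x}) filter_topology (act s)"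
proof -
  let ?X = "subtopology filter_topology {x\<in>filters. s\<^sup>\<star> * s \<in> x}"
  have top: "topspace ?X = {x\<in>filters. s\<^sup>\<star> * s \<in> x}"
    by (auto simp: topspace_filter_topology)
  have c: "continuous_map ?X (discrete_topology UNIV) (\<lambda>x. e \<in> act s x)" if e: "e \<in> idems" for e
  proof (rule continuous_map_eq)
    show "continuous_map ?X (discrete_topology UNIV) (\<lambda>x. s\<^sup>\<star> * e * s \<in> x)"
      by (rule continuous_map_from_subtopology[OF continuous_map_mem_filter[OF conj_star_idems[OF e]]])
  qed (use mem_act e top in auto)
  show ?thesis
    unfolding filter_topology_def
  proof (rule continuous_map_pullback', fold filter_topology_def)
    have "continuous_map ?X (product_topology (\<lambda>_. discrete_topology UNIV) idems)
            (\<lambda>x. \<lambda>e\<in>idems. e \<in> act s x)"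
      using c by (auto simp: continuous_map_componentwise)
    then show "continuous_map ?X (product_topology (\<lambda>_. discrete_topology UNIV) idems)
            ((\<lambda>x. \<lambda>e\<in>idems. e \<in> x) \<circ> act s)"
      by (simp add: o_def)
  qed (use top act_filter in auto)
qed

text \<open>
  A continuous map on an open set of filters carries points of the closure of the ultrafilters to
  points of the closure of their images, and those are again ultrafilters.
\<close>

lemma act_tight:
  fixes s :: "'a::{inverse_semigroup, mult_zero}"
  assumes x: "x \<in> tight_filters" and sx: "s\<^sup>\<star> * s \<in> x"
  shows "act s x \<in> tight_filters"
proof -
  have xf: "x \<in> filters" using x tight_filters_subset by auto
  let ?D = "{x\<in>filters. s\<^sup>\<star> * s \<in> x}"
  have xc: "\<forall>T. x \<in> T \<and> openin filter_topology T \<longrightarrow> (\<exists>y\<in>ultrafilters. y \<in> T)"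
    using x unfolding tight_filters_def in_closure_of by blast
  have "\<exists>y\<in>ultrafilters. y \<in> T" if T: "openin filter_topology T" "act s x \<in> T" for T
  proof -
    have "openin (subtopology filter_topology ?D)
            {y \<in> topspace (subtopology filter_topology ?D). act s y \<in> T}"
      by (rule openin_continuous_map_preimage[OF continuous_map_act T(1)])
    then have o: "openin filter_topology {y \<in> ?D. act s y \<in> T}"
      using openin_trans_full[OF _ openin_filter_mem[OF idems_star_mult[of s]]]
      by (simp add: topspace_filter_topology inf.absorb2 Int_def conj_ac)
    have "x \<in> {y \<in> ?D. act s y \<in> T}" using xf sx T by auto
    then obtain y where y: "y \<in> ultrafilters" "y \<in> {y \<in> ?D. act s y \<in> T}"
      using xc o by meson
    then have "act s y \<in> ultrafilters" "act s y \<in> T" using act_ultrafilter[of y s] by simp_all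
    then show ?thesis by blast
  qed
  then show ?thesis
    using act_filter[OF xf sx] unfolding tight_filters_def in_closure_of topspace_filter_topology
    by blast
qed

text \<open>
  Zorn's lemma above the principal filter of \<open>e\<close>.
\<close>

lemma idem_in_ultrafilter:
  fixes e :: "'a::{inverse_semigroup, mult_zero}"
  assumes e: "e \<in> idems" "e \<noteq> 0"
  shows "\<exists>x\<in>ultrafilters. e \<in> x"
proof -
  let ?A = "{x\<in>filters. e \<in> x}"
  have "{f\<in>idems. f * e = e} \<in> ?A"
    (is "?up \<in> _")
  proof -
    have eu: "e \<in> ?up" using e(1) by (simp add: idems_def)
    have "?up \<in> filters"
    proof (rule filterI[OF eu])
      show "?up \<subseteq> idems" by blast
      show "0 \<notin> ?up" using e(2) by simp
      show "f * g \<in> ?up" if "f \<in> ?up" "g \<in> ?up" for f g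
        using that by (simp add: idems_mult mult.assoc)
      show "g \<in> ?up" if "f \<in> ?up" "g \<in> idems" "g * f = f" for f g
      proof -
        have "g * (f * e) = f * e" using that(3) by (simp add: mult.assoc[symmetric])
        then show ?thesis using that by simp
      qed
    qed
    then show ?thesis using eu by blast
  qed
  then have "?A \<noteq> {}" by blast
  moreover have "\<Union>C \<in> ?A" if C: "C \<noteq> {}" "subset.chain ?A C" for C
  proof -
    have CA: "C \<subseteq> ?A" and lin: "\<And>x y. x \<in> C \<Longrightarrow> y \<in> C \<Longrightarrow> x \<subseteq> y \<or> y \<subseteq> x"
      using C(2) by (auto simp: subset.chain_def)
    have "f * g \<in> \<Union>C" if fg: "f \<in> \<Union>C" "g \<in> \<Union>C" for f g
    proof -
      obtain x y where "x \<in> C" "f \<in> x" "y \<in> C" "g \<in> y" using fg by blast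
      then obtain z where "z \<in> C" "f \<in> z" "g \<in> z" using lin[of x y] by blast
      then show ?thesis using CA filter_mult[of z f g] by blast
    qed
    moreover have "g \<in> \<Union>C" if "f \<in> \<Union>C" "g \<in> idems" "g * f = f" for f g
      using that CA filter_up[of _ f g] by blast
    moreover have "\<Union>C \<subseteq> idems" using CA filter_idems by blast
    moreover have "0 \<notin> \<Union>C" using CA zero_notin_filter by blast
    moreover have eC: "e \<in> \<Union>C" using C(1) CA by blast
    ultimately have "\<Union>C \<in> filters" by (intro filterI[OF eC])
    then show ?thesis using eC by blast
  qed
  ultimately obtain x where x: "x \<in> ?A" "\<forall>y\<in>?A. x \<subseteq> y \<longrightarrow> y = x"
    using subset_Zorn_nonempty[of ?A] by blast
  then show ?thesis by (auto simp: ultrafilters_def)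
qed

text \<open>
  If no product \<open>e * g\<close> with \<open>g \<in> y\<close> vanished, these products would generate a filter containing
  \<open>y\<close> and \<open>e\<close>, against maximality.
\<close>

lemma ultrafilter_avoids:
  fixes e :: "'a::{inverse_semigroup, mult_zero}"
  assumes y: "y \<in> ultrafilters" and e: "e \<in> idems" "e \<notin> y"
  shows "\<exists>g\<in>y. e * g = 0"
proof (rule ccontr)
  assume n: "\<not> (\<exists>g\<in>y. e * g = 0)"
  have yf: "y \<in> filters" using y by (simp add: ultrafilters_def)
  let ?z = "{f\<in>idems. \<exists>g\<in>y. f * (e * g) = e * g}"
  have up: "f' \<in> ?z" if "f \<in> ?z" "f' \<in> idems" "f' * f = f" for f f'
  proof -
    obtain g where g: "g \<in> y" "f * (e * g) = e * g" using \<open>f \<in> ?z\<close> by blast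
    have "f' * (f * (e * g)) = f * (e * g)" using that(3) by (simp only: mult.assoc[symmetric])
    then show ?thesis using g that(2) by auto
  qed
  have mu: "f * f' \<in> ?z" if f: "f \<in> ?z" "f' \<in> ?z" for f f'
  proof -
    obtain g g' where g: "g \<in> y" "f * (e * g) = e * g" "g' \<in> y" "f' * (e * g') = e * g'"
      and i: "f \<in> idems" "f' \<in> idems" using f by blast
    have gi: "g \<in> idems" "g' \<in> idems" using g filter_idems[OF yf] by auto
    have 1: "f * (e * (g * g')) = e * (g * g')" using g(2) by (metis mult.assoc)
    have "f' * (e * (g' * g)) = e * (g' * g)" using g(4) by (metis mult.assoc)
    then have "f' * (e * (g * g')) = e * (g * g')" by (simp add: idems_commute[OF gi])
    then have "f * f' * (e * (g * g')) = e * (g * g')" using 1 by (simp add: mult.assoc)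
    then show ?thesis using filter_mult[OF yf g(1,3)] idems_mult[OF i] by blast
  qed
  have sub: "y \<subseteq> ?z"
  proof
    fix f assume f: "f \<in> y"
    have fi: "f \<in> idems" using filter_idems[OF yf f] .
    have "f * (e * f) = e * f" using idems_left_commute[OF fi e(1), of f] fi by (simp add: idems_def)
    then show "f \<in> ?z" using f fi by blast
  qed
  have "0 \<notin> ?z" using n by auto
  moreover have eI: "e \<in> ?z"
  proof -
    obtain g where "g \<in> y" using filter_nonempty[OF yf] by blast
    then show ?thesis using e(1) mult_idem_left[OF e(1), of g] by blast
  qed
  moreover have "?z \<subseteq> idems" by blast
  ultimately have "?z \<in> filters" using up mu by (intro filterI[OF eI])
  then have "?z = y" using y sub unfolding ultrafilters_def by blast
  then show False using eI e(2) by blast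
qed

text \<open>
  A basic neighbourhood prescribes finitely many idempotents to belong or not to belong to a filter.
  At an ultrafilter, not containing \<open>e\<close> is forced by containing some \<open>h\<close> with \<open>e * h = 0\<close>, so all the
  prescriptions follow from membership of one idempotent. At other tight filters this can fail.
\<close>

lemma ultrafilter_basis:
  fixes y :: "'a::{inverse_semigroup, mult_zero} set"
  assumes y: "y \<in> ultrafilters" and U: "openin tight_topology U" and yU: "y \<in> U"
  shows "\<exists>e\<in>y. dom_of e \<subseteq> U"
proof -
  have yf: "y \<in> filters" using y by (simp add: ultrafilters_def)
  \<comment> \<open>one member of \<open>y\<close> decides any finite set of idempotents in the same way as \<open>y\<close> does\<close>
  have fin: "\<exists>g\<in>y. \<forall>x\<in>filters. g \<in> x \<longrightarrow> (\<forall>e\<in>F. e \<in> x \<longleftrightarrow> e \<in> y)"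
    if "finite F" "F \<subseteq> idems" for F
    using that
  proof (induction F)
    case empty
    have "y \<noteq> {}" using filter_nonempty[OF yf] by blast
    then show ?case by blast
  next
    case (insert e F)
    have ei: "e \<in> idems" "F \<subseteq> idems" using insert.prems by auto
    obtain g where g: "g \<in> y" "\<forall>x\<in>filters. g \<in> x \<longrightarrow> (\<forall>e\<in>F. e \<in> x \<longleftrightarrow> e \<in> y)"
      using insert.IH[OF ei(2)] by blast
    have "\<exists>h\<in>y. \<forall>x\<in>filters. h \<in> x \<longrightarrow> (e \<in> x \<longleftrightarrow> e \<in> y)"
    proof (cases "e \<in> y")
      case False
      then obtain h where h: "h \<in> y" "e * h = 0" using ultrafilter_avoids[OF y ei(1)] by blast
      have "e \<notin> x" if "x \<in> filters" "h \<in> x" for x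
        using filter_mult[OF that(1), of e h] zero_notin_filter[OF that(1)] that(2) h(2) by auto
      then show ?thesis using h False by blast
    qed blast
    then obtain h where h: "h \<in> y" "\<forall>x\<in>filters. h \<in> x \<longrightarrow> (e \<in> x \<longleftrightarrow> e \<in> y)" by blast
    have i: "g \<in> idems" "h \<in> idems" using g h filter_idems[OF yf] by auto
    have "h * (g * h) = g * h"
      using idems_left_commute[OF i(2,1), of h] i(2) by (simp add: idems_def)
    then have "g \<in> x \<and> h \<in> x" if "x \<in> filters" "g * h \<in> x" for x
      using filter_up[OF that i(1)] filter_up[OF that i(2)] mult_idem_left[OF i(1), of h] by blast
    then have "\<forall>x\<in>filters. g * h \<in> x \<longrightarrow> (\<forall>e'\<in>insert e F. e' \<in> x \<longleftrightarrow> e' \<in> y)"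
      using g(2) h(2) by blast
    then show ?case using filter_mult[OF yf g(1) h(1)] by blast
  qed
  obtain V where V: "openin filter_topology V" "U = V \<inter> tight_filters"
    using U by (auto simp: tight_topology_def openin_subtopology)
  let ?P = "product_topology (\<lambda>_. discrete_topology (UNIV :: bool set)) (idems :: 'a set)"
  obtain W where W: "openin ?P W" "V = (\<lambda>x. \<lambda>e\<in>idems. e \<in> x) -` W \<inter> filters"
    using V(1) unfolding filter_topology_def openin_pullback_topology by blast
  have yW: "(\<lambda>e\<in>idems. e \<in> y) \<in> W" using yU V W by auto
  obtain B where B: "finite {i \<in> idems. B i \<noteq> UNIV}"
      "(\<lambda>e\<in>idems. e \<in> y) \<in> Pi\<^sub>E idems B" "Pi\<^sub>E idems B \<subseteq> W"
    using W(1) yW unfolding openin_product_topology_alt by fastforce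
  obtain g where g: "g \<in> y" "\<forall>x\<in>filters. g \<in> x \<longrightarrow> (\<forall>e\<in>{i \<in> idems. B i \<noteq> UNIV}. e \<in> x \<longleftrightarrow> e \<in> y)"
    using fin[OF B(1)] by blast
  have "x \<in> U" if x: "x \<in> dom_of g" for x
  proof -
    have xf: "x \<in> filters" "g \<in> x" "x \<in> tight_filters" using x tight_filters_subset by (auto simp: dom_of_def)
    have "(e \<in> x) \<in> B e" if e: "e \<in> idems" for e
    proof (cases "B e = UNIV")
      case False
      then have "e \<in> x \<longleftrightarrow> e \<in> y" using g(2) xf e by blast
      moreover have "(e \<in> y) \<in> B e" using PiE_mem[OF B(2) e] e by simp
      ultimately show ?thesis by simp
    qed simp
    then have "(\<lambda>e\<in>idems. e \<in> x) \<in> W" using B(3) by auto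
    then show ?thesis using V W xf by auto
  qed
  then show ?thesis using g(1) by blast
qed


section \<open>Germs and trivially fixed points\<close>

text \<open>
  For an idempotent \<open>e\<close> the relation \<open>e \<preceq> s\<close> reads \<open>s * e = e\<close>, and \<open>e \<noteq> 0\<close> is automatic for members
  of a filter.
\<close>

lemma trivially_fixed_iff:
  fixes s :: "'a::{inverse_semigroup, mult_zero}"
  shows "x \<in> trivially_fixed s \<longleftrightarrow> x \<in> tight_filters \<and> (\<exists>e\<in>x. s * e = e)"
proof -
  have "e \<in> idems" "e \<noteq> 0" if "x \<in> tight_filters" "e \<in> x" for e
    using that tight_filters_subset filter_idems[of x e] zero_notin_filter[of x] by auto
  then show ?thesis
    by (auto simp: trivially_fixed_def dom_of_def idems_le)
qed

lemma trivially_fixed_iff_unit: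
  fixes s :: "'a::{inverse_semigroup, mult_zero}"
  assumes x: "x \<in> dom_of (s\<^sup>\<star> * s)"
  shows "x \<in> trivially_fixed s \<longleftrightarrow> germ s x = unit_at tight_groupoid x"
proof -
  have xt: "x \<in> tight_filters" and sx: "s\<^sup>\<star> * s \<in> x" using x by (auto simp: dom_of_def)
  let ?p = "s\<^sup>\<star> * s"
  have pp: "?p\<^sup>\<star> * ?p = ?p" by (simp add: star_mult star_star mult.assoc star_regular_assoc)
  have u: "unit_at tight_groupoid x = germ ?p x" using unit_at_germ[OF x] .
  show ?thesis
  proof
    assume "x \<in> trivially_fixed s"
    then obtain e where e: "e \<in> x" "s * e = e" by (auto simp: trivially_fixed_iff)
    have ei: "e \<in> idems" using tight_filter_idems[OF xt e(1)] .
    have es: "e * s\<^sup>\<star> = e" using arg_cong[OF e(2), of star] by (simp add: star_mult idems_star[OF ei])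
    have "e = (e * s\<^sup>\<star>) * (s * e)" using e(2) es ei by (simp add: idems_def)
    also have "\<dots> = e * (?p * e)" by (simp add: mult.assoc)
    also have "\<dots> = ?p * e"
      using idems_left_commute[OF ei idems_star_mult[of s], of e] ei by (simp add: idems_def)
    finally have "s * e = ?p * e" using e(2) by simp
    then show "germ s x = unit_at tight_groupoid x"
      unfolding u using x e(1) pp by (intro germ_eqI[of x s ?p e]) simp_all
  next
    assume "germ s x = unit_at tight_groupoid x"
    then have "(s, x) \<in> germ ?p x" using germ_self[OF x] u by simp
    then obtain e where e: "e \<in> x" "?p * e = s * e" by (auto simp: mem_germ)
    have ei: "e \<in> idems" using tight_filter_idems[OF xt e(1)] .
    have "s * (?p * e) = s * e" by (simp add: mult.assoc star_regular_assoc)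
    then have "s * (?p * e) = ?p * e" using e(2) by simp
    then show "x \<in> trivially_fixed s"
      using xt tight_filter_mult[OF xt sx e(1)] by (auto simp: trivially_fixed_iff)
  qed
qed

text \<open>
  Continuity of \<open>germ s\<close>. It suffices to look at the generating sets \<open>germ t ` V\<close>, whether or not they
  form a basis: \<open>s\<close> and \<open>t\<close> have the same germ exactly on the union of those \<open>dom_of e\<close> on which
  \<open>s * e = t * e\<close>.
\<close>

lemma openin_germ_preimage:
  fixes s :: "'a::inverse_semigroup"
  assumes W: "openin (arrows tight_groupoid) W"
  shows "openin tight_topology {x \<in> dom_of (s\<^sup>\<star> * s). germ s x \<in> W}"
proof -
  let ?D = "dom_of (s\<^sup>\<star> * s)"
  have D: "openin tight_topology ?D" by (simp add: openin_dom_of)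
  have arr: "arrows tight_groupoid = topology_generated_by (germ_basis :: 'a germ set set)"
    by (simp add: tight_groupoid_def)
  have topD: "topspace (subtopology tight_topology ?D) = ?D"
    using openin_subset[OF D] by auto
  have "continuous_map (subtopology tight_topology ?D) (topology_generated_by germ_basis) (germ s)"
  proof (rule continuous_on_generated_topo)
    fix U :: "'a germ set" assume "U \<in> germ_basis"
    then obtain t V where U: "U = germ t ` V" and V: "V \<subseteq> dom_of (t\<^sup>\<star> * t)" "openin tight_topology V"
      by (auto simp: germ_basis_def)
    have eq: "germ s -` U \<inter> ?D = ?D \<inter> (\<Union>e\<in>{e\<in>idems. s * e = t * e}. V \<inter> dom_of e)"
    proof (intro set_eqI iffI)
      fix x assume "x \<in> germ s -` U \<inter> ?D"
      then obtain y where x: "x \<in> ?D" and y: "y \<in> V" "germ s x = germ t y" using U by auto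
      have "(s, x) \<in> germ t y" using germ_self[OF x] y by simp
      then obtain e where e: "x = y" "e \<in> x" "t * e = s * e" by (auto simp: mem_germ)
      then show "x \<in> ?D \<inter> (\<Union>e\<in>{e\<in>idems. s * e = t * e}. V \<inter> dom_of e)"
        using x y tight_filter_idems[of x e] by (auto simp: dom_of_def)
    next
      fix x assume "x \<in> ?D \<inter> (\<Union>e\<in>{e\<in>idems. s * e = t * e}. V \<inter> dom_of e)"
      then obtain e where "x \<in> ?D" "s * e = t * e" "x \<in> V" "e \<in> x" by (auto simp: dom_of_def)
      then have "germ s x = germ t x" using V(1) by (intro germ_eqI) auto
      then show "x \<in> germ s -` U \<inter> ?D" using U \<open>x \<in> V\<close> \<open>x \<in> ?D\<close> by auto
    qed
    have "openin tight_topology (\<Union>e\<in>{e\<in>idems. s * e = t * e}. V \<inter> dom_of e)"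
      using V(2) openin_dom_of by (intro openin_Union) auto
    then show "openin (subtopology tight_topology ?D) (germ s -` U \<inter> topspace (subtopology tight_topology ?D))"
      unfolding topD eq by (rule openin_subtopology_Int2)
  next
    show "germ s ` topspace (subtopology tight_topology ?D) \<subseteq> \<Union> germ_basis"
    proof -
      have "germ s ` ?D \<in> germ_basis" using D unfolding germ_basis_def by blast
      then show ?thesis unfolding topD by (rule Union_upper)
    qed
  qed
  then have "openin (subtopology tight_topology ?D)
      {x \<in> topspace (subtopology tight_topology ?D). germ s x \<in> W}"
    using W unfolding arr by (rule openin_continuous_map_preimage)
  then show ?thesis
    unfolding topD using openin_trans_full[OF _ D] by blast
qed

lemma openin_germ_image:
  fixes s :: "'a::inverse_semigroup"
  assumes "openin tight_topology U" "U \<subseteq> dom_of (s\<^sup>\<star> * s)"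
  shows "openin (arrows tight_groupoid) (germ s ` U)"
  using assms by (auto simp: tight_groupoid_def germ_basis_def intro: topology_generated_by_Basis)

lemma germ_isotropy_iff:
  fixes s :: "'a::inverse_semigroup"
  assumes x: "x \<in> dom_of (s\<^sup>\<star> * s)"
  shows "germ s x \<in> isotropy tight_groupoid \<longleftrightarrow> x \<in> fixed_points s"
  unfolding isotropy_def fixed_points_def topspace_arrows
  using x by (auto simp: source_of_germ range_of_germ)

lemma unit_space_eq:
  "unit_space tight_groupoid = unit_at tight_groupoid ` (tight_filters :: 'a::inverse_semigroup set set)"
  unfolding unit_space_def by (simp add: topspace_tight[symmetric]) (simp add: tight_groupoid_def)

lemma germ_unit_iff:
  fixes s :: "'a::{inverse_semigroup, mult_zero}"
  assumes x: "x \<in> dom_of (s\<^sup>\<star> * s)"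
  shows "germ s x \<in> unit_space tight_groupoid \<longleftrightarrow> x \<in> trivially_fixed s"
proof -
  have "source_of tight_groupoid (unit_at tight_groupoid y) = y" if y: "y \<in> tight_filters" for y :: "'a set"
  proof -
    obtain e where e: "e \<in> y" using y tight_filters_subset filter_nonempty[of y] by blast
    have "e\<^sup>\<star> * e = e"
      using tight_filter_idems[OF y e] by (simp add: idems_star) (simp add: idems_def)
    then have "y \<in> dom_of (e\<^sup>\<star> * e)" "y \<in> dom_of e" using y e by (auto simp: dom_of_def)
    then show ?thesis using unit_at_germ[of y e] source_of_germ[of y e] by simp
  qed
  then have "germ s x \<in> unit_space tight_groupoid \<longleftrightarrow> germ s x = unit_at tight_groupoid x"
    using source_of_germ[OF x] x unfolding unit_space_eq by (auto simp: dom_of_def)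
  then show ?thesis using trivially_fixed_iff_unit[OF x] by simp
qed

lemma unit_space_subset_interior:
  "unit_space tight_groupoid \<subseteq>
     arrows tight_groupoid interior_of isotropy (tight_groupoid :: ('a::inverse_semigroup germ, 'a set) top_groupoid)"
proof
  fix \<gamma> assume "\<gamma> \<in> unit_space (tight_groupoid :: ('a germ, 'a set) top_groupoid)"
  then obtain x :: "'a set" where x: "x \<in> tight_filters" "\<gamma> = unit_at tight_groupoid x"
    by (auto simp: unit_space_eq)
  obtain e where e: "e \<in> x" using x(1) tight_filters_subset filter_nonempty[of x] by blast
  have ei: "e \<in> idems" using tight_filter_idems[OF x(1) e] .
  have ee: "e\<^sup>\<star> * e = e" using ei by (simp add: idems_star) (simp add: idems_def)
  have "act e y = y" if "y \<in> dom_of e" for y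
    using that act_idem[of y e] tight_filters_subset by (auto simp: dom_of_def)
  then have "germ e ` dom_of e \<subseteq> isotropy tight_groupoid"
    using germ_isotropy_iff[of _ e] ee by (auto simp: fixed_points_def)
  moreover have "openin (arrows tight_groupoid) (germ e ` dom_of e)"
    using openin_germ_image[OF openin_dom_of[OF ei], of e] ee by simp
  moreover have "\<gamma> \<in> germ e ` dom_of e"
    using x e unit_at_germ[of x e] by (auto simp: dom_of_def)
  ultimately show "\<gamma> \<in> arrows tight_groupoid interior_of isotropy tight_groupoid"
    by (auto simp: interior_of_def)
qed

lemma essentially_principal_iff:
  "essentially_principal (tight_groupoid :: ('a::{inverse_semigroup, mult_zero} germ, 'a set) top_groupoid) \<longleftrightarrow>
     (\<forall>s::'a. tight_topology interior_of fixed_points s \<subseteq> trivially_fixed s)"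
  (is "?E \<longleftrightarrow> ?T")
proof
  assume E: ?E
  show ?T
  proof (intro allI subsetI)
    fix s :: 'a and x assume x: "x \<in> tight_topology interior_of fixed_points s"
    let ?U = "tight_topology interior_of fixed_points s"
    have UF: "?U \<subseteq> fixed_points s" by (rule interior_of_subset)
    have UD: "?U \<subseteq> dom_of (s\<^sup>\<star> * s)" using UF by (auto simp: fixed_points_def)
    have "germ s ` ?U \<subseteq> isotropy tight_groupoid"
      using UF UD germ_isotropy_iff[of _ s] by blast
    then have "germ s ` ?U \<subseteq> arrows tight_groupoid interior_of isotropy tight_groupoid"
      using openin_germ_image[OF openin_interior_of UD] by (rule interior_of_maximal)
    then have "germ s x \<in> unit_space tight_groupoid" using E x unfolding essentially_principal_def by blast
    then show "x \<in> trivially_fixed s" using germ_unit_iff x UD by blast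
  qed
next
  assume T: ?T
  have "\<gamma> \<in> unit_space tight_groupoid"
    if \<gamma>: "\<gamma> \<in> arrows tight_groupoid interior_of isotropy tight_groupoid" for \<gamma> :: "'a germ"
  proof -
    let ?W = "arrows tight_groupoid interior_of isotropy (tight_groupoid :: ('a germ, 'a set) top_groupoid)"
    have WI: "?W \<subseteq> isotropy tight_groupoid" by (rule interior_of_subset)
    obtain s x where x: "\<gamma> = germ s x" "x \<in> dom_of (s\<^sup>\<star> * s)"
    proof -
      have "\<gamma> \<in> topspace (arrows tight_groupoid)" using \<gamma> interior_of_subset_topspace by (rule rev_subsetD)
      then show ?thesis using that unfolding topspace_arrows by blast
    qed
    let ?V = "{y \<in> dom_of (s\<^sup>\<star> * s). germ s y \<in> ?W}"
    have "?V \<subseteq> fixed_points s" using WI germ_isotropy_iff[of _ s] by blast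
    then have "?V \<subseteq> tight_topology interior_of fixed_points s"
      using openin_germ_preimage[OF openin_interior_of] by (rule interior_of_maximal)
    then show ?thesis using T x \<gamma> germ_unit_iff[OF x(2)] by blast
  qed
  then show ?E unfolding essentially_principal_def using unit_space_subset_interior by blast
qed

section \<open>Reduction to the core\<close>

text \<open>
  At a point \<open>x\<close> that is not trivially fixed, \<open>germ s x\<close> differs from the unit at \<open>x\<close>, which is the
  germ of \<open>s\<^sup>\<star> * s\<close>. Disjoint neighbourhoods of the two germs pull back to a neighbourhood of \<open>x\<close> on
  which the germs of \<open>s\<close> and \<open>s\<^sup>\<star> * s\<close> never agree. It contains an ultrafilter, where they do agree.
\<close>

lemma trivially_fixed_if_ultrafilters:
  fixes s :: "'a::{inverse_semigroup, mult_zero}"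
  assumes H: "Hausdorff_space (arrows (tight_groupoid :: ('a germ, 'a set) top_groupoid))"
    and U: "openin tight_topology U" "U \<subseteq> dom_of (s\<^sup>\<star> * s)"
    and ultra: "\<And>y. y \<in> ultrafilters \<Longrightarrow> y \<in> U \<Longrightarrow> y \<in> trivially_fixed s"
  shows "U \<subseteq> trivially_fixed s"
proof (rule subsetI, rule ccontr)
  fix x assume x: "x \<in> U" and n: "x \<notin> trivially_fixed s"
  let ?p = "s\<^sup>\<star> * s"
  have pp: "?p\<^sup>\<star> * ?p = ?p" by (simp add: star_mult star_star mult.assoc star_regular_assoc)
  have u: "unit_at tight_groupoid y = germ ?p y" if "y \<in> dom_of ?p" for y
    using unit_at_germ[OF that] .
  have xd: "x \<in> dom_of ?p" using x U by blast
  have "germ s x \<noteq> germ ?p x" using n trivially_fixed_iff_unit[OF xd] u[OF xd] by simp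
  moreover have "germ s x \<in> topspace (arrows tight_groupoid)" "germ ?p x \<in> topspace (arrows tight_groupoid)"
    using xd pp unfolding topspace_arrows by force+
  ultimately obtain V W where VW: "openin (arrows tight_groupoid) V" "openin (arrows tight_groupoid) W"
      "germ s x \<in> V" "germ ?p x \<in> W" "disjnt V W"
    using H unfolding Hausdorff_space_def by blast
  let ?N = "U \<inter> ({y \<in> dom_of ?p. germ s y \<in> V} \<inter> {y \<in> dom_of (?p\<^sup>\<star> * ?p). germ ?p y \<in> W})"
  have "openin tight_topology ?N"
    by (intro openin_Int U openin_germ_preimage VW)
  moreover have "x \<in> ?N" using x xd VW pp by simp
  ultimately obtain y where "y \<in> ultrafilters" "y \<in> ?N" using open_contains_ultrafilter by blast
  then have "germ s y = germ ?p y" "germ s y \<in> V" "germ ?p y \<in> W"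
    using ultra[of y] trivially_fixed_iff_unit[of y s] u[of y] by auto
  then show False using VW(5) by (auto simp: disjnt_def)
qed

text \<open>
  An idempotent lying in every ultrafilter has nonzero product with each nonzero \<open>e\<close>, because the two
  are contained together in an ultrafilter.
\<close>

lemma core_if_tight_fixed:
  fixes u :: "'a::{inverse_semigroup, mult_zero}"
  assumes F: "fixed_points u = tight_filters"
  shows "u \<in> core"
proof -
  have mem: "u\<^sup>\<star> * u \<in> y \<and> u * u\<^sup>\<star> \<in> y" if y: "y \<in> ultrafilters" for y
  proof -
    have "y \<in> fixed_points u" "y \<in> filters"
      using y F ultrafilters_tight by (auto simp: ultrafilters_def)
    then have "u\<^sup>\<star> * u \<in> y" "act u y = y" by (auto simp: fixed_points_def dom_of_def)
    then show ?thesis using act_range_proj[OF \<open>y \<in> filters\<close>] by metis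
  qed
  have "u\<^sup>\<star> * u * e \<noteq> 0 \<and> u * u\<^sup>\<star> * e \<noteq> 0" if nz: "e \<in> idems" "e \<noteq> 0" for e
  proof -
    obtain y where y: "y \<in> ultrafilters" "e \<in> y" using idem_in_ultrafilter[OF nz] by blast
    then have "y \<in> filters" by (simp add: ultrafilters_def)
    then have "u\<^sup>\<star> * u * e \<in> y" "u * u\<^sup>\<star> * e \<in> y" "0 \<notin> y"
      using y mem filter_mult zero_notin_filter by blast+
    then show ?thesis by metis
  qed
  then show ?thesis by (auto simp: core_def)
qed

text \<open>
  Since \<open>t\<^sup>\<star> * t = 1\<close>, the action of \<open>t\<close> is defined on every tight filter and takes values in
  \<open>dom_of (t * t\<^sup>\<star>)\<close>, where \<open>s\<close> acts trivially; the action of \<open>t\<^sup>\<star>\<close> then leads back.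
\<close>

lemma fixed_corner:
  fixes s t :: "'a::{inverse_semigroup, monoid_mult, mult_zero}"
  assumes t: "t\<^sup>\<star> * t = 1" and F: "dom_of (t * t\<^sup>\<star>) \<subseteq> fixed_points s"
  shows "fixed_points (t\<^sup>\<star> * s * t) = tight_filters"
proof -
  let ?u = "t\<^sup>\<star> * s * t"
  have "?u\<^sup>\<star> * ?u \<in> w \<and> act ?u w = w" if w: "w \<in> tight_filters" for w
  proof -
    have wf: "w \<in> filters" using w tight_filters_subset by blast
    obtain e where "e \<in> w" using filter_nonempty[OF wf] by blast
    then have "1 \<in> w" using filter_up[OF wf, of e 1] by (simp add: idems_def)
    then have tw: "t\<^sup>\<star> * t \<in> w" using t by simp
    let ?v = "act t w"
    have v: "?v \<in> tight_filters" "?v \<in> filters" "t * t\<^sup>\<star> \<in> ?v"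
      using act_tight[OF w tw] act_filter[OF wf tw] act_range_proj[OF wf tw] by auto
    then have "?v \<in> fixed_points s" using F by (auto simp: dom_of_def)
    then have sv: "s\<^sup>\<star> * s \<in> ?v" "act s ?v = ?v" by (auto simp: fixed_points_def dom_of_def)
    have st: "(s * t)\<^sup>\<star> * (s * t) \<in> w" "act (s * t) w = ?v"
      using act_mult[OF wf tw v(2) sv(1)] sv(2) by auto
    show ?thesis
      using act_mult[OF wf st(1), of "t\<^sup>\<star>"] st(2) v act_star_act[OF wf tw] by (simp add: star_star mult.assoc)
  qed
  then show ?thesis by (auto simp: fixed_points_def dom_of_def)
qed

text \<open>
  If \<open>u = t\<^sup>\<star> * s * t\<close> fixes the idempotent \<open>f\<close> from the left, then for \<open>h = t * f * t\<^sup>\<star>\<close> one gets only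
  \<open>t * t\<^sup>\<star> * s * h = h\<close>. Moving \<open>t * t\<^sup>\<star>\<close> past \<open>s\<close> turns it into the idempotent \<open>k = s\<^sup>\<star> * (t * t\<^sup>\<star>) * s\<close>,
  which belongs to \<open>y\<close> because \<open>y\<close> is fixed; then \<open>k * h\<close> is the idempotent below \<open>s\<close> that is needed.
\<close>

lemma trivially_fixed_corner:
  fixes s t :: "'a::{inverse_semigroup, mult_zero}"
  assumes y: "y \<in> tight_filters" "t * t\<^sup>\<star> \<in> y" and s: "y \<in> fixed_points s"
    and triv: "act (t\<^sup>\<star>) y \<in> trivially_fixed (t\<^sup>\<star> * s * t)"
  shows "y \<in> trivially_fixed s"
proof -
  have yf: "y \<in> filters" using y tight_filters_subset by blast
  have ty: "t\<^sup>\<star>\<^sup>\<star> * t\<^sup>\<star> \<in> y" using y by (simp add: star_star)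
  obtain f where f: "f \<in> act (t\<^sup>\<star>) y" "t\<^sup>\<star> * s * t * f = f" using triv by (auto simp: trivially_fixed_iff)
  have fi: "f \<in> idems" using f by (auto simp: act_def)
  define h k where "h = t * f * t\<^sup>\<star>" and "k = s\<^sup>\<star> * (t * t\<^sup>\<star>) * s"
  have h: "h \<in> y" using f(1) fi by (simp add: mem_act[OF yf ty] h_def star_star)
  have hi: "h \<in> idems" using filter_idems[OF yf h] .
  have "t * t\<^sup>\<star> \<in> act s y" using y(2) s by (simp add: fixed_points_def)
  then have k: "k \<in> y" using mem_act[OF yf, of s "t * t\<^sup>\<star>"] s by (auto simp: fixed_points_def dom_of_def k_def)
  have ki: "k \<in> idems" using filter_idems[OF yf k] .
  have "s * k = s * s\<^sup>\<star> * (t * t\<^sup>\<star>) * s" by (simp add: k_def mult.assoc)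
  also have "\<dots> = t * t\<^sup>\<star> * (s * s\<^sup>\<star>) * s" by (simp add: idems_commute)
  also have "\<dots> = t * t\<^sup>\<star> * s" by (simp add: mult.assoc star_regular_assoc)
  finally have "s * (k * h) = t * (t\<^sup>\<star> * s * t * f) * t\<^sup>\<star>" by (metis h_def mult.assoc)
  then have 1: "s * (k * h) = h" by (simp add: f(2) h_def)
  \<comment> \<open>\<open>s\<close> maps \<open>k * h\<close> to \<open>h\<close>, so multiplying by \<open>k * h\<close> once more gives \<open>h * (k * h) = k * h\<close>\<close>
  have "s * (k * h) = s * (k * h) * (k * h)"
    using idems_mult[OF ki hi] by (simp add: idems_def mult.assoc)
  also have "\<dots> = k * h"
    unfolding 1 using idems_left_commute[OF hi ki, of h] hi by (simp add: idems_def)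
  finally show ?thesis
    using filter_mult[OF yf k h] y(1) by (auto simp: trivially_fixed_iff)
qed

theorem propositionA3:
  assumes "\<And>e. e \<in> idems - {0 :: 'a::{inverse_semigroup, monoid_mult, mult_zero, countable}} \<Longrightarrow>
             \<exists>s. s * s\<^sup>\<star> = e \<and> s\<^sup>\<star> * s = 1"
    and "Hausdorff_space (arrows (tight_groupoid :: ('a germ, 'a set) top_groupoid))"
  shows "essentially_principal (tight_groupoid :: ('a germ, 'a set) top_groupoid) \<longleftrightarrow>
         (\<forall>s\<in>core :: 'a set. tight_topology interior_of fixed_points s \<subseteq> trivially_fixed s)"
proof -
  have "tight_topology interior_of fixed_points s \<subseteq> trivially_fixed s"
    if core: "\<forall>s\<in>core :: 'a set. tight_topology interior_of fixed_points s \<subseteq> trivially_fixed s"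
    for s :: 'a
  proof (rule trivially_fixed_if_ultrafilters[OF assms(2) openin_interior_of])
    have IF: "tight_topology interior_of fixed_points s \<subseteq> fixed_points s" by (rule interior_of_subset)
    then show "tight_topology interior_of fixed_points s \<subseteq> dom_of (s\<^sup>\<star> * s)"
      by (auto simp: fixed_points_def)
    fix y assume y: "y \<in> ultrafilters" "y \<in> tight_topology interior_of fixed_points s"
    have yt: "y \<in> tight_filters" and yf: "y \<in> filters"
      using y ultrafilters_tight by (auto simp: ultrafilters_def)
    obtain e where e: "e \<in> y" "dom_of e \<subseteq> tight_topology interior_of fixed_points s"
      using ultrafilter_basis[OF y(1) openin_interior_of y(2)] by blast
    have "e \<in> idems - {0}" using e(1) filter_idems[OF yf] zero_notin_filter[OF yf] by auto
    then obtain t where t: "t * t\<^sup>\<star> = e" "t\<^sup>\<star> * t = 1" using assms(1) by blast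
    let ?u = "t\<^sup>\<star> * s * t"
    have F: "fixed_points ?u = tight_filters" using fixed_corner[OF t(2)] e(2) IF t(1) by blast
    have "tight_topology interior_of fixed_points ?u = tight_filters"
      unfolding F by (metis interior_of_topspace topspace_tight)
    then have "tight_filters \<subseteq> trivially_fixed ?u" using core core_if_tight_fixed[OF F] by blast
    moreover have "act (t\<^sup>\<star>) y \<in> tight_filters"
      using act_tight[OF yt, of "t\<^sup>\<star>"] e(1) t(1) by (simp add: star_star)
    ultimately show "y \<in> trivially_fixed s"
      using trivially_fixed_corner[OF yt, of t s] e(1) t(1) y(2) IF by blast
  qed
  then show ?thesis unfolding essentially_principal_iff by blast
qed

end
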